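(* Let $n\ge2$ be an integer and let $\mathcal P_{2n-1}(z)=P_{2n-1}(z)/P'_{2n-1}(0)$ be the normalized Legendre polynomial of odd degree $2n-1$. Let $\phi$ be a Ma-Minda function, let $\alpha$ be the radius of the largest open disk $\{w:|w-1|<\alpha\}$ contained in $\phi(\mathbb D)$, and suppose $\phi(-1)=1-\alpha$. Then for $\mathcal P_{2n-1}$ one has $R[\mathcal C(\phi)]=R[\mathcal C(1+\alpha z)]$, and this common radius is the smallest positive root $r(\mathcal P_{2n-1})$ of the equation $$r\,\mathcal P''_{2n-1}(r)+\alpha\,\mathcal P'_{2n-1}(r)=0.$$
   Context: Legendre polynomials: $P_m(z)=\frac1{2^m m!}\frac{d^m}{dz^m}(z^2-1)^m$. $\mathbb D$ is the open unit disk, $\mathcal A$ the analytic functions $f$ on $\mathbb D$ with $f(0)=0$, $f'(0)=1$. A Ma-Minda function is an analytic univalent $\phi$ on $\mathbb D$ with $\Re\phi>0$, $\phi(0)=1$, $\phi'(0)>0$, and $\phi(\mathbb D)$ starlike with respect to $1$ and symmetric about the real axis; $\phi(-1)$ means $\lim_{x\to-1^+}\phi(x)$. $\mathcal C(\phi)=\{f\in\mathcal A: 1+zf''(z)/f'(z)\prec\phi(z)\}$, where $\prec$ is subordination; since $\phi$ is univalent this means $1+zf''(z)/f'(z)\in\phi(\mathbb D)$ on $\mathbb D$. The case $\phi(z)=1+\alpha z$ gives $\mathcal C(1+\alpha z)$. Radius: for $f$ analytic near $0$ with $f(0)=0$, $f'(0)=1$, the $\mathcal C(\phi)$-radius $R[\mathcal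 C(\phi)]$ of $f$ is the largest $r_0>0$ (not required to be $\le1$) such that $f$ is analytic with $f'\ne0$ in $|z|<r_0$, and $1+zf''(z)/f'(z)\in\phi(\mathbb D)$ for all $|z|<r_0$. *)

theory Defs
  imports "HOL-Analysis.Analysis" "HOL-Computational_Algebra.Polynomial"
begin

definition legendre :: "nat \<Rightarrow> complex poly" where
  "legendre m = smult (1 / (2 ^ m * fact m)) ((pderiv ^^ m) ([:-1, 0, 1:] ^ m))"

text \<open>\<open>P\<^sub>m / P\<^sub>m'(0)\<close>, meaningful for odd \<open>m\<close>; for even \<open>m\<close> the derivative vanishes at \<open>0\<close>.\<close>

definition normalized_legendre :: "nat \<Rightarrow> complex poly" where
  "normalized_legendre m = smult (1 / poly (pderiv (legendre m)) 0) (legendre m)"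

definition ma_minda :: "(complex \<Rightarrow> complex) \<Rightarrow> bool" where
  "ma_minda \<phi> \<longleftrightarrow>
     \<phi> holomorphic_on ball 0 1 \<and>
     inj_on \<phi> (ball 0 1) \<and>
     (\<forall>z\<in>ball 0 1. Re (\<phi> z) > 0) \<and>
     \<phi> 0 = 1 \<and>
     Im (deriv \<phi> 0) = 0 \<and> Re (deriv \<phi> 0) > 0 \<and>
     (\<forall>w\<in>\<phi> ` ball 0 1. closed_segment 1 w \<subseteq> \<phi> ` ball 0 1) \<and>
     (\<forall>w\<in>\<phi> ` ball 0 1. cnj w \<in> \<phi> ` ball 0 1)"

definition largest_disk_radius :: "complex \<Rightarrow> complex set \<Rightarrow> real \<Rightarrow> bool" where
  "largest_disk_radius c S \<alpha> \<longleftrightarrow>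
     ball c \<alpha> \<subseteq> S \<and> (\<forall>\<beta>. ball c \<beta> \<subseteq> S \<longrightarrow> \<beta> \<le> \<alpha>)"

text \<open>Subordination of \<open>1 + z f''(z) / f'(z)\<close> to a univalent \<open>\<phi>\<close> is membership in the
  image of the unit disk; \<open>r\<close> itself may exceed \<open>1\<close>.\<close>

definition C_on_disk :: "(complex \<Rightarrow> complex) \<Rightarrow> (complex \<Rightarrow> complex) \<Rightarrow> real \<Rightarrow> bool" where
  "C_on_disk \<phi> f r \<longleftrightarrow>
     r > 0 \<and> f holomorphic_on ball 0 r \<and>
     (\<forall>z\<in>ball 0 r. deriv f z \<noteq> 0 \<and>
        1 + z * deriv (deriv f) z / deriv f z \<in> \<phi> ` ball 0 1)"

text \<open>A relation rather than a function, since no largest \<open>r\<close> need exist in general;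
  \<open>r\<close> is unique when it does.\<close>

definition is_C_radius :: "(complex \<Rightarrow> complex) \<Rightarrow> (complex \<Rightarrow> complex) \<Rightarrow> real \<Rightarrow> bool" where
  "is_C_radius \<phi> f r \<longleftrightarrow>
     f 0 = 0 \<and> deriv f 0 = 1 \<and>
     C_on_disk \<phi> f r \<and> (\<forall>s. C_on_disk \<phi> f s \<longrightarrow> s \<le> r)"

definition smallest_positive_root :: "(real \<Rightarrow> complex) \<Rightarrow> real \<Rightarrow> bool" where
  "smallest_positive_root g r \<longleftrightarrow>
     r > 0 \<and> g r = 0 \<and> (\<forall>s>0. g s = 0 \<longrightarrow> r \<le> s)"

end

theory Submission
  imports Defs "HOL-Computational_Algebra.Fundamental_Theorem_Algebra"
begin

text \<open>The derivative \<open>q\<close> of the normalized Legendre polynomial is even, and by Gauss--Lucas it has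
  only real zeros \<open>a\<close>, so \<open>z q'(z) / q(z)\<close> is a sum of terms \<open>z\<^sup>2 / (z\<^sup>2 - a\<^sup>2)\<close>. Each such term is
  bounded on \<open>|z| = r\<close> by minus its value at \<open>z = r\<close>, and this bound increases with \<open>r\<close>. Hence the
  image of the disk of radius \<open>r\<close> under \<open>1 + z q'(z) / q(z)\<close> lies in the disk of radius \<open>\<alpha>\<close> around
  \<open>1\<close> precisely until the point \<open>1 - \<alpha>\<close> is reached at \<open>z = r\<close>; and \<open>1 - \<alpha>\<close> is not a value of the
  univalent function \<open>\<phi>\<close>, being a boundary limit of it.\<close>

section \<open>Logarithmic derivatives of polynomials\<close>

text \<open>Product rule, one root at a time. Keeping the product as a factor on the right, instead
  of dividing by it, suits the induction.\<close>

lemma log_pderiv_prod_linear: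
  fixes m :: "complex \<Rightarrow> nat"
  assumes "finite A" "z \<notin> A"
  shows "poly (pderiv (\<Prod>a\<in>A. [:-a, 1:] ^ m a)) z
    = poly (\<Prod>a\<in>A. [:-a, 1:] ^ m a) z * (\<Sum>a\<in>A. of_nat (m a) / (z - a))"
  using assms
proof (induction A rule: finite_induct)
  case empty
  then show ?case by simp
next
  case (insert a A)
  have "z - a \<noteq> 0" using insert by auto
  have "poly (pderiv ([:-a, 1:] ^ k)) z = poly ([:-a, 1:] ^ k) z * (of_nat k / (z - a))" for k
    using \<open>z - a \<noteq> 0\<close>
    by (cases k) (simp_all add: pderiv_power_Suc pderiv_pCons del: power_Suc of_nat_Suc, simp)
  then show ?case
    using insert by (simp add: pderiv_mult algebra_simps)
qed

text \<open>Over the complex numbers \<open>p\<close> splits into linear factors, and the leading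
  coefficient cancels in the quotient.\<close>

lemma log_pderiv:
  fixes p :: "complex poly"
  assumes "poly p z \<noteq> 0"
  shows "poly (pderiv p) z / poly p z = (\<Sum>a | poly p a = 0. of_nat (order a p) / (z - a))"
proof -
  define A where "A = {a. poly p a = 0}"
  define P where "P = (\<Prod>a\<in>A. [:-a, 1:] ^ order a p)"
  have p: "p = smult (lead_coeff p) P"
    unfolding A_def P_def by (rule complex_poly_decompose [symmetric])
  have "p \<noteq> 0" using assms by auto
  then have "finite A" unfolding A_def by (rule poly_roots_finite)
  moreover have "z \<notin> A" using assms by (simp add: A_def)
  ultimately have "poly (pderiv P) z = poly P z * (\<Sum>a\<in>A. of_nat (order a p) / (z - a))"
    unfolding P_def by (rule log_pderiv_prod_linear)
  then have "poly (pderiv p) z = poly p z * (\<Sum>a\<in>A. of_nat (order a p) / (z - a))"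
    by (subst (1 2) p) (simp add: pderiv_smult)
  then show ?thesis using assms by (simp add: A_def)
qed

definition real_rooted :: "complex poly \<Rightarrow> bool" where
  "real_rooted p \<longleftrightarrow> (\<forall>z. poly p z = 0 \<longrightarrow> Im z = 0)"

text \<open>The case of Gauss-Lucas for the real line. At a nonreal \<open>z\<close>, every term
  \<open>1 / (z - a)\<close> with \<open>a\<close> real has an imaginary part of sign opposite to
  \<open>Im z\<close>, so the logarithmic derivative cannot vanish there.\<close>

lemma real_rooted_pderiv:
  assumes "real_rooted p" "degree p > 0"
  shows "real_rooted (pderiv p)"
  unfolding real_rooted_def
proof (intro allI impI, rule ccontr)
  fix z assume z: "poly (pderiv p) z = 0" "Im z \<noteq> 0"
  define A where "A = {a. poly p a = 0}"
  have "p \<noteq> 0" using assms by auto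
  have "finite A" unfolding A_def using \<open>p \<noteq> 0\<close> by (rule poly_roots_finite)
  have "A \<noteq> {}"
    using fundamental_theorem_of_algebra[of p] assms(2) by (auto simp: A_def constant_degree)
  have "poly p z \<noteq> 0" using assms(1) z by (auto simp: real_rooted_def)
  then have "(\<Sum>a\<in>A. of_nat (order a p) / (z - a)) = 0"
    using log_pderiv[of p z] z by (simp add: A_def)
  then have "Im (\<Sum>a\<in>A. of_nat (order a p) / (z - a)) = 0" by simp
  moreover have "Im (of_nat (order a p) / (z - a))
      = - Im z * (of_nat (order a p) / (norm (z - a))\<^sup>2)" if "a \<in> A" for a
  proof -
    have "Im a = 0" using that assms(1) by (auto simp: A_def real_rooted_def)
    then show ?thesis by (simp add: Im_divide cmod_power2)
  qed
  ultimately have "Im z * (\<Sum>a\<in>A. of_nat (order a p) / (norm (z - a))\<^sup>2) = 0"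
    by (simp add: sum_distrib_left sum_negf del: sum_eq_0_iff)
  moreover have "(\<Sum>a\<in>A. of_nat (order a p) / (norm (z - a))\<^sup>2) > 0"
  proof (rule sum_pos)
    fix a assume "a \<in> A"
    then have "order a p \<noteq> 0" "z \<noteq> a"
      using \<open>p \<noteq> 0\<close> \<open>poly p z \<noteq> 0\<close> by (auto simp: A_def order_root)
    then show "real (order a p) / (norm (z - a))\<^sup>2 > 0" by simp
  qed fact+
  ultimately show False using z by simp
qed

text \<open>The bound on \<open>k\<close> ensures that only nonconstant polynomials get
  differentiated.\<close>

lemma real_rooted_higher_pderiv:
  assumes "real_rooted p" "k \<le> degree p"
  shows "real_rooted ((pderiv ^^ k) p)"
  using assms(2)
  by (induction k) (auto simp: assms(1) degree_higher_pderiv intro!: real_rooted_pderiv)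

text \<open>Differentiating an even polynomial \<open>k\<close> times shifts its coefficients by
  \<open>k\<close> places, which gives it the parity of \<open>k\<close>.\<close>

lemma higher_pderiv_reflect:
  fixes p :: "complex poly"
  assumes "\<And>z. poly p (- z) = poly p z"
  shows "poly ((pderiv ^^ k) p) (- z) = (-1) ^ k * poly ((pderiv ^^ k) p) z"
proof -
  have "p \<circ>\<^sub>p [:0, -1:] = p"
    using assms by (simp add: poly_pcompose fun_eq_iff flip: poly_eq_poly_eq_iff)
  then have coeff: "(-1) ^ i * coeff p i = coeff p i" for i
    by (metis coeff_pcompose_linear)
  have "(pderiv ^^ k) p \<circ>\<^sub>p [:0, -1:] = smult ((-1) ^ k) ((pderiv ^^ k) p)"
  proof (rule poly_eqI)
    fix i
    \<comment> \<open>Evenness is inserted at index \<open>i + k\<close>, so that the two factors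
      \<open>(-1) ^ i\<close> cancel and only \<open>(-1) ^ k\<close> remains.\<close>
    have "(-1) ^ i * coeff p (i + k) = (-1) ^ i * ((-1) ^ (i + k) * coeff p (i + k))"
      by (simp only: coeff)
    also have "\<dots> = (-1) ^ k * coeff p (i + k)"
      by (simp add: power_add flip: mult.assoc power_mult_distrib)
    finally show "coeff ((pderiv ^^ k) p \<circ>\<^sub>p [:0, -1:]) i = coeff (smult ((-1) ^ k) ((pderiv ^^ k) p)) i"
      by (simp add: coeff_pcompose_linear coeff_higher_pderiv)
  qed
  from arg_cong[OF this, of "\<lambda>p. poly p z"] show ?thesis
    by (simp add: poly_pcompose)
qed

section \<open>Even polynomials with real zeros\<close>

text \<open>The left side is an even function of \<open>z\<close>, so its partial fraction sums at
  \<open>z\<close> and \<open>- z\<close> may be averaged. This replaces a pairing of the zeros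
  \<open>a\<close> and \<open>- a\<close>. Writing \<open>(Re a)\<^sup>2\<close> for
  \<open>a\<^sup>2\<close> makes the real constants visible for the later estimates.\<close>

lemma even_log_pderiv:
  fixes q :: "complex poly"
  assumes even: "\<And>z. poly q (- z) = poly q z" and "real_rooted q" and "poly q z \<noteq> 0"
  shows "z * poly (pderiv q) z / poly q z
    = (\<Sum>a | poly q a = 0. of_nat (order a q) * (z\<^sup>2 / (z\<^sup>2 - of_real ((Re a)\<^sup>2))))"
proof -
  define A where "A = {a. poly q a = 0}"
  define h where "h = z * poly (pderiv q) z / poly q z"
  have "h = z * (\<Sum>a\<in>A. of_nat (order a q) / (z - a))"
    unfolding h_def A_def times_divide_eq_right [symmetric] log_pderiv[OF assms(3)] ..
  \<comment> \<open>The derivative of \<open>q\<close> is odd, so replacing \<open>z\<close> by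
    \<open>- z\<close> leaves \<open>h\<close> unchanged.\<close>
  moreover have "h = - z * (poly (pderiv q) (- z) / poly q (- z))"
    using higher_pderiv_reflect[of q 1 z, OF even] by (simp add: h_def even)
  then have "h = - z * (\<Sum>a\<in>A. of_nat (order a q) / (- z - a))"
    using log_pderiv[of q "- z"] assms(3) by (simp only: A_def even simp_thms not_False_eq_True)
  ultimately have "2 * h = z * (\<Sum>a\<in>A. of_nat (order a q) / (z - a))
      + - z * (\<Sum>a\<in>A. of_nat (order a q) / (- z - a))"
    by (metis mult_2)
  also have "\<dots> = (\<Sum>a\<in>A. of_nat (order a q) * (z / (z - a) + - z / (- z - a)))"
    unfolding sum_distrib_left sum.distrib [symmetric]
    by (intro sum.cong refl) (simp add: algebra_simps)
  also have "\<dots> = (\<Sum>a\<in>A. 2 * (of_nat (order a q) * (z\<^sup>2 / (z\<^sup>2 - of_real ((Re a)\<^sup>2)))))"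
  proof (rule sum.cong [OF refl])
    fix a assume a: "a \<in> A"
    then have "a = of_real (Re a)"
      using assms(2) by (simp add: A_def real_rooted_def complex_eq_iff)
    then have sq: "of_real ((Re a)\<^sup>2) = a\<^sup>2" by (metis of_real_power)
    have "z - a \<noteq> 0" "z + a \<noteq> 0" "- z - a \<noteq> 0"
      using a assms(3) even[of a] by (auto simp: A_def add_eq_0_iff)
    then have "z / (z - a) + - z / (- z - a) = 2 * (z\<^sup>2 / ((z - a) * (z + a)))"
      by (simp add: divide_simps) (simp add: algebra_simps power2_eq_square)
    then show "of_nat (order a q) * (z / (z - a) + - z / (- z - a))
        = 2 * (of_nat (order a q) * (z\<^sup>2 / (z\<^sup>2 - of_real ((Re a)\<^sup>2))))"
      unfolding sq by (simp add: power2_eq_square algebra_simps)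
  qed
  finally have "h = (\<Sum>a\<in>A. of_nat (order a q) * (z\<^sup>2 / (z\<^sup>2 - of_real ((Re a)\<^sup>2))))"
    unfolding sum_distrib_left [symmetric] by simp
  then show ?thesis by (simp only: h_def A_def)
qed

text \<open>The radius \<open>r\<close> solves \<open>G r = \<alpha>\<close> below the smallest
  modulus \<open>\<rho>\<close> of a zero. Here \<open>G\<close> bounds the logarithmic derivative
  on circles and is attained, up to sign, at real points. Positive degree supplies a zero; with
  none, \<open>G\<close> would vanish identically.\<close>

lemma even_real_rooted_radius:
  fixes q :: "complex poly" and \<alpha> :: real
  assumes even: "\<And>z. poly q (- z) = poly q z" and real: "real_rooted q"
    and deg: "degree q > 0" and q0: "poly q 0 \<noteq> 0" and "\<alpha> > 0"
  obtains r where "r > 0"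
    "\<And>z. norm z < r \<Longrightarrow> poly q z \<noteq> 0 \<and> norm (z * poly (pderiv q) z / poly q z) < \<alpha>"
    "poly q (of_real r) \<noteq> 0"
    "of_real r * poly (pderiv q) (of_real r) / poly q (of_real r) = - of_real \<alpha>"
proof -
  define A where "A = {a. poly q a = 0}"
  define \<rho> where "\<rho> = Min ((\<lambda>a. \<bar>Re a\<bar>) ` A)"
  define G where "G = (\<lambda>x. \<Sum>a\<in>A. real (order a q) * (x\<^sup>2 / ((Re a)\<^sup>2 - x\<^sup>2)))"
  have "q \<noteq> 0" using deg by auto
  have fin: "finite A" unfolding A_def using \<open>q \<noteq> 0\<close> by (rule poly_roots_finite)
  have ne: "A \<noteq> {}"
    using fundamental_theorem_of_algebra[of q] deg by (auto simp: A_def constant_degree)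
  have Im0: "Im a = 0" if "a \<in> A" for a
    using that real by (simp add: A_def real_rooted_def)
  have ord: "order a q > 0" if "a \<in> A" for a
    using that \<open>q \<noteq> 0\<close> by (simp add: A_def order_root)
  have \<rho>_le: "\<rho> \<le> \<bar>Re a\<bar>" if "a \<in> A" for a
    using that fin by (simp add: \<rho>_def)
  have "\<rho> \<in> (\<lambda>a. \<bar>Re a\<bar>) ` A" unfolding \<rho>_def using fin ne by (intro Min_in) auto
  then obtain b where b: "b \<in> A" "\<rho> = \<bar>Re b\<bar>" by auto
  have "\<rho> > 0"
  proof (rule ccontr)
    assume "\<not> \<rho> > 0"
    then have "b = 0" using b Im0[of b] by (simp add: complex_eq_iff)
    then show False using b q0 by (simp add: A_def)
  qed
  have pos: "x\<^sup>2 < (Re a)\<^sup>2" if "a \<in> A" "0 \<le> x" "x < \<rho>" for a x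
    using power_strict_mono[of x "\<bar>Re a\<bar>" 2] that \<rho>_le[of a] by simp
  have nz: "poly q z \<noteq> 0" if "norm z < \<rho>" for z
  proof
    assume "poly q z = 0"
    then have "z \<in> A" by (simp add: A_def)
    then show False using \<rho>_le[of z] abs_Re_le_cmod[of z] that by linarith
  qed
  have mono: "G x < G y" if "0 \<le> x" "x < y" "y < \<rho>" for x y
    unfolding G_def
  proof (rule sum_strict_mono [OF fin ne])
    fix a assume a: "a \<in> A"
    have "x\<^sup>2 < y\<^sup>2" using that by (simp add: power_strict_mono)
    \<comment> \<open>The numerator grows while the denominator shrinks but stays positive below
      \<open>\<rho>\<close>.\<close>
    then have "x\<^sup>2 / ((Re a)\<^sup>2 - x\<^sup>2) < y\<^sup>2 / ((Re a)\<^sup>2 - y\<^sup>2)"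
      using pos[OF a, of x] pos[OF a, of y] that by (intro frac_less) auto
    then show "real (order a q) * (x\<^sup>2 / ((Re a)\<^sup>2 - x\<^sup>2)) < real (order a q) * (y\<^sup>2 / ((Re a)\<^sup>2 - y\<^sup>2))"
      using ord[OF a] by (intro mult_strict_left_mono) auto
  qed
  have cont: "continuous_on {0..x} G" if "x < \<rho>" for x
    unfolding G_def using pos that by (intro continuous_intros) fastforce
  have bound: "norm (z * poly (pderiv q) z / poly q z) \<le> G (norm z)" if "norm z < \<rho>" for z
  proof -
    have "norm (z * poly (pderiv q) z / poly q z)
        = norm (\<Sum>a\<in>A. of_nat (order a q) * (z\<^sup>2 / (z\<^sup>2 - of_real ((Re a)\<^sup>2))))"
      using even_log_pderiv[OF even real nz[OF that]] by (simp add: A_def)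
    also have "\<dots> \<le> (\<Sum>a\<in>A. real (order a q) * ((norm z)\<^sup>2 / ((Re a)\<^sup>2 - (norm z)\<^sup>2)))"
    proof (rule sum_norm_le)
      fix a assume a: "a \<in> A"
      \<comment> \<open>Reverse triangle inequality; its left side is positive, so it may replace
        the denominator.\<close>
      have "(Re a)\<^sup>2 - (norm z)\<^sup>2 \<le> norm (z\<^sup>2 - of_real ((Re a)\<^sup>2))"
        using norm_triangle_ineq3[of "of_real ((Re a)\<^sup>2)" "z\<^sup>2"]
        by (simp add: norm_power norm_minus_commute flip: of_real_power)
      then show "norm (of_nat (order a q) * (z\<^sup>2 / (z\<^sup>2 - of_real ((Re a)\<^sup>2))))
          \<le> real (order a q) * ((norm z)\<^sup>2 / ((Re a)\<^sup>2 - (norm z)\<^sup>2))"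
        unfolding norm_mult norm_divide norm_power
        using pos[OF a, of "norm z"] that
        by (intro mult_mono divide_left_mono mult_pos_pos) auto
    qed
    finally show ?thesis by (simp add: G_def)
  qed
  have at_real: "of_real x * poly (pderiv q) (of_real x) / poly q (of_real x) = - of_real (G x)"
    if "0 \<le> x" "x < \<rho>" for x
  proof -
    have "of_real x * poly (pderiv q) (of_real x) / poly q (of_real x)
        = (\<Sum>a\<in>A. of_nat (order a q) * ((of_real x)\<^sup>2 / ((of_real x)\<^sup>2 - of_real ((Re a)\<^sup>2))))"
      using even_log_pderiv[OF even real nz] that by (simp add: A_def)
    also have "\<dots> = (\<Sum>a\<in>A. - of_real (real (order a q) * (x\<^sup>2 / ((Re a)\<^sup>2 - x\<^sup>2))))"
    proof (rule sum.cong [OF refl])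
      fix a assume "a \<in> A"
      have "x\<^sup>2 / (x\<^sup>2 - (Re a)\<^sup>2) = - (x\<^sup>2 / ((Re a)\<^sup>2 - x\<^sup>2))"
        by (metis minus_diff_eq minus_divide_right)
      then have "real (order a q) * (x\<^sup>2 / (x\<^sup>2 - (Re a)\<^sup>2))
          = - (real (order a q) * (x\<^sup>2 / ((Re a)\<^sup>2 - x\<^sup>2)))"
        by simp
      from arg_cong[OF this, of complex_of_real]
      show "of_nat (order a q) * ((of_real x)\<^sup>2 / ((of_real x)\<^sup>2 - of_real ((Re a)\<^sup>2)))
          = - complex_of_real (real (order a q) * (x\<^sup>2 / ((Re a)\<^sup>2 - x\<^sup>2)))"
        by simp
    qed
    finally show ?thesis by (simp add: G_def sum_negf)
  qed
  \<comment> \<open>At \<open>y\<close> the summand of \<open>G\<close> belonging to the smallest zero already equals \<open>\<alpha>\<close>.\<close>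
  define y where "y = \<rho> * sqrt (\<alpha> / (1 + \<alpha>))"
  have y2: "y\<^sup>2 = \<rho>\<^sup>2 * (\<alpha> / (1 + \<alpha>))"
    using \<open>\<alpha> > 0\<close> by (simp add: y_def power_mult_distrib)
  have "y \<ge> 0" using \<open>\<rho> > 0\<close> \<open>\<alpha> > 0\<close> by (simp add: y_def)
  have "y < \<rho>" using \<open>\<rho> > 0\<close> \<open>\<alpha> > 0\<close> by (simp add: y_def)
  have "(Re b)\<^sup>2 - y\<^sup>2 = \<rho>\<^sup>2 / (1 + \<alpha>)"
    unfolding y2 using b \<open>\<alpha> > 0\<close> by (simp add: field_simps)
  then have "y\<^sup>2 / ((Re b)\<^sup>2 - y\<^sup>2) = \<alpha>"
    using \<open>\<alpha> > 0\<close> \<open>\<rho> > 0\<close> by (simp add: y2)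
  then have "\<alpha> \<le> real (order b q) * (y\<^sup>2 / ((Re b)\<^sup>2 - y\<^sup>2))"
    using ord[OF b(1)] \<open>\<alpha> > 0\<close> by simp
  also have "\<dots> \<le> G y"
    unfolding G_def
  proof (rule member_le_sum [OF b(1) _ fin])
    fix a assume "a \<in> A - {b}"
    then show "0 \<le> real (order a q) * (y\<^sup>2 / ((Re a)\<^sup>2 - y\<^sup>2))"
      using pos[of a y] \<open>y \<ge> 0\<close> \<open>y < \<rho>\<close> by simp
  qed
  finally have "\<alpha> \<le> G y" .
  moreover have "G 0 \<le> \<alpha>" using \<open>\<alpha> > 0\<close> by (simp add: G_def)
  ultimately obtain r where r: "0 \<le> r" "r \<le> y" "G r = \<alpha>"
    using IVT'[of G 0 \<alpha> y] cont[OF \<open>y < \<rho>\<close>] \<open>y \<ge> 0\<close> by auto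
  have "r \<noteq> 0" using r \<open>\<alpha> > 0\<close> by (auto simp: G_def)
  have "r < \<rho>" using r \<open>y < \<rho>\<close> by simp
  show ?thesis
  proof
    show "r > 0" using r \<open>r \<noteq> 0\<close> by simp
    show "poly q z \<noteq> 0 \<and> norm (z * poly (pderiv q) z / poly q z) < \<alpha>" if "norm z < r" for z
      \<comment> \<open>Strict monotonicity turns the bound \<open>G (norm z)\<close> into something
        below \<open>G r = \<alpha>\<close>.\<close>
      using that nz[of z] bound[of z] mono[of "norm z" r] r \<open>r < \<rho>\<close> by force
    show "poly q (of_real r) \<noteq> 0" using nz r \<open>r < \<rho>\<close> by simp
    show "of_real r * poly (pderiv q) (of_real r) / poly q (of_real r) = - of_real \<alpha>"
      using at_real r \<open>r < \<rho>\<close> by simp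
  qed
qed

section \<open>Legendre polynomials\<close>

lemma poly_base_reflect: "poly ([:-1, 0, 1:] ^ m) (- z) = poly ([:-1, 0, 1:] ^ m) (z :: complex)"
  by (simp add: poly_power)

lemma real_rooted_base: "real_rooted ([:-1, 0, 1:] ^ m)"
proof -
  have "Im z = 0" if "z * z = 1" for z :: complex
    using that square_eq_1_iff[of z] by auto
  then show ?thesis by (auto simp: real_rooted_def poly_power)
qed

lemma degree_base: "degree ([:-1, 0, 1 :: complex:] ^ m) = 2 * m"
  by (simp add: degree_power_eq)

text \<open>By the binomial theorem this coefficient is a binomial coefficient up to sign. It shows
  that the normalization divides by a nonzero number.\<close>

lemma coeff_base_even_nonzero:
  assumes "k \<le> m"
  shows "coeff ([:-1, 0, 1 :: complex:] ^ m) (2 * k) \<noteq> 0"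
proof -
  have "[:-1, 0, 1 :: complex:] = monom 1 2 + [:-1:]"
    by (simp add: monom_altdef numeral_2_eq_2)
  then have "[:-1, 0, 1 :: complex:] ^ m
      = (\<Sum>i\<le>m. of_nat (m choose i) * monom 1 2 ^ i * [:-1:] ^ (m - i))"
    by (simp only: binomial_ring)
  also have "\<dots> = (\<Sum>i\<le>m. monom (of_nat (m choose i) * (-1) ^ (m - i)) (2 * i))"
    by (intro sum.cong refl)
       (simp add: monom_power of_nat_poly smult_monom poly_const_pow mult.commute)
  finally have "coeff ([:-1, 0, 1 :: complex:] ^ m) (2 * k)
      = (\<Sum>i\<le>m. if i = k then of_nat (m choose i) * (-1) ^ (m - i) else 0)"
    by (simp add: coeff_sum)
  also have "\<dots> = of_nat (m choose k) * (-1) ^ (m - k)"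
    using assms by (simp add: sum.delta')
  finally show ?thesis using assms by simp
qed

lemma pderiv_legendre:
  "pderiv (legendre m) = smult (1 / (2 ^ m * fact m)) ((pderiv ^^ Suc m) ([:-1, 0, 1:] ^ m))"
  by (simp add: legendre_def pderiv_smult)

text \<open>Up to a nonzero factor, the value at \<open>0\<close> is the coefficient of degree
  \<open>Suc m\<close> in \<open>[:-1, 0, 1:] ^ m\<close>, an even degree when \<open>m\<close> is
  odd.\<close>

lemma pderiv_legendre_0:
  assumes "odd m"
  shows "poly (pderiv (legendre m)) 0 \<noteq> 0"
proof -
  from assms obtain j where "m = 2 * j + 1" by (rule oddE)
  then obtain k where k: "Suc m = 2 * k" "k \<le> m" using that[of "Suc j"] by simp
  \<comment> \<open>This is the factorial of \<open>2 * k\<close>, the factor that differentiating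
    \<open>Suc m\<close> times puts in front of that coefficient.\<close>
  have "pochhammer (1 :: complex) (2 * k) \<noteq> 0"
    by (simp flip: pochhammer_fact)
  then show ?thesis
    using coeff_base_even_nonzero[of k m] k
    by (simp add: pderiv_legendre poly_0_coeff_0 coeff_higher_pderiv del: funpow.simps)
qed

text \<open>Parity, location of zeros and degree are insensitive to a nonzero scalar, so they can be
  read off from the iterated derivative.\<close>

lemma pderiv_normalized_legendre:
  assumes "odd m"
  obtains c where "c \<noteq> 0"
    "pderiv (normalized_legendre m) = smult c ((pderiv ^^ Suc m) ([:-1, 0, 1:] ^ m))"
proof
  show "1 / poly (pderiv (legendre m)) 0 * (1 / (2 ^ m * fact m)) \<noteq> 0"
    using pderiv_legendre_0[OF assms] by simp
  show "pderiv (normalized_legendre m)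
    = smult (1 / poly (pderiv (legendre m)) 0 * (1 / (2 ^ m * fact m)))
        ((pderiv ^^ Suc m) ([:-1, 0, 1:] ^ m))"
    unfolding normalized_legendre_def pderiv_smult
    \<comment> \<open>Only the polynomial itself is expanded; the occurrence inside the normalizing
      constant stays.\<close>
    by (subst (2) pderiv_legendre) (simp only: smult_smult)
qed

text \<open>For odd \<open>m\<close> the Legendre polynomial is an odd function.\<close>

lemma normalized_legendre_0:
  assumes "odd m"
  shows "poly (normalized_legendre m) 0 = 0"
  using higher_pderiv_reflect[of "[:-1, 0, 1:] ^ m" m 0, OF poly_base_reflect] assms
  by (simp add: normalized_legendre_def legendre_def)

lemma pderiv_normalized_legendre_0:
  assumes "odd m"
  shows "poly (pderiv (normalized_legendre m)) 0 = 1"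
  using pderiv_legendre_0[OF assms] by (simp add: normalized_legendre_def pderiv_smult)

lemma pderiv_normalized_legendre_reflect:
  assumes "odd m"
  shows "poly (pderiv (normalized_legendre m)) (- z) = poly (pderiv (normalized_legendre m)) z"
proof -
  obtain c where "pderiv (normalized_legendre m) = smult c ((pderiv ^^ Suc m) ([:-1, 0, 1:] ^ m))"
    using pderiv_normalized_legendre[OF assms] by metis
  then show ?thesis
    using higher_pderiv_reflect[of "[:-1, 0, 1:] ^ m" "Suc m" z, OF poly_base_reflect] assms
    by (simp del: funpow.simps)
qed

lemma real_rooted_pderiv_normalized_legendre:
  assumes "odd m"
  shows "real_rooted (pderiv (normalized_legendre m))"
proof -
  obtain c where "c \<noteq> 0"
    "pderiv (normalized_legendre m) = smult c ((pderiv ^^ Suc m) ([:-1, 0, 1:] ^ m))"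
    using pderiv_normalized_legendre[OF assms] by metis
  moreover have "real_rooted ((pderiv ^^ Suc m) ([:-1, 0, 1:] ^ m))"
    \<comment> \<open>Oddness gives \<open>m \<ge> 1\<close>, hence
      \<open>Suc m \<le> 2 * m\<close>.\<close>
    using assms by (intro real_rooted_higher_pderiv real_rooted_base) (auto simp: degree_base elim: oddE)
  ultimately show ?thesis by (simp add: real_rooted_def del: funpow.simps)
qed

lemma degree_pderiv_normalized_legendre:
  assumes "odd m"
  shows "degree (pderiv (normalized_legendre m)) = m - 1"
proof -
  obtain c where "c \<noteq> 0"
    "pderiv (normalized_legendre m) = smult c ((pderiv ^^ Suc m) ([:-1, 0, 1:] ^ m))"
    using pderiv_normalized_legendre[OF assms] by metis
  then show ?thesis by (simp add: degree_higher_pderiv degree_base del: funpow.simps)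
qed

section \<open>Radii of convexity\<close>

lemma deriv_poly: "deriv (poly p) = poly (pderiv (p :: complex poly))"
  by (rule ext) (rule DERIV_imp_deriv [OF poly_DERIV])

text \<open>All that matters about \<open>\<phi>\<close> is that its image contains the disk and
  misses the point \<open>1 - \<alpha>\<close>, so both radii of the theorem follow from this one
  criterion. A larger disk would contain the point \<open>r\<close>, where the value
  \<open>1 - \<alpha>\<close> is taken.\<close>

lemma is_C_radius_polyI:
  fixes f :: "complex poly"
  assumes "poly f 0 = 0" "poly (pderiv f) 0 = 1" "r > 0"
    and "\<And>z. norm z < r \<Longrightarrow> poly (pderiv f) z \<noteq> 0 \<and>
      norm (z * poly (pderiv (pderiv f)) z / poly (pderiv f) z) < \<alpha>"
    and val: "of_real r * poly (pderiv (pderiv f)) (of_real r) / poly (pderiv f) (of_real r) = - of_real \<alpha>"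
    and sub: "ball 1 \<alpha> \<subseteq> \<phi> ` ball 0 1" and notin: "1 - of_real \<alpha> \<notin> \<phi> ` ball 0 1"
  shows "is_C_radius \<phi> (poly f) r"
  unfolding is_C_radius_def deriv_poly C_on_disk_def
proof (intro conjI allI impI ballI)
  fix z :: complex assume "z \<in> ball 0 r"
  then have "norm z < r" by simp
  note * = assms(4)[OF this]
  then show "poly (pderiv f) z \<noteq> 0" by simp
  show "1 + z * poly (pderiv (pderiv f)) z / poly (pderiv f) z \<in> \<phi> ` ball 0 1"
    using * sub by (auto simp: dist_norm)
next
  fix s
  assume s: "0 < s \<and> poly f holomorphic_on ball 0 s \<and> (\<forall>z\<in>ball 0 s. poly (pderiv f) z \<noteq> 0 \<and>
      1 + z * poly (pderiv (pderiv f)) z / poly (pderiv f) z \<in> \<phi> ` ball 0 1)"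
  show "s \<le> r"
  proof (rule ccontr)
    assume "\<not> s \<le> r"
    then have "complex_of_real r \<in> ball 0 s" using \<open>r > 0\<close> by simp
    then have "1 + of_real r * poly (pderiv (pderiv f)) (of_real r) / poly (pderiv f) (of_real r)
        \<in> \<phi> ` ball 0 1"
      using s by blast
    then show False using notin by (simp add: val)
  qed
qed (use assms in \<open>auto intro!: holomorphic_intros\<close>)

text \<open>If \<open>L\<close> were a value at an interior point, the image of a smaller disk
  around \<open>0\<close> would be a neighbourhood of \<open>L\<close>, by invariance of domain.
  Points near \<open>-1\<close> would then share their values with points of that smaller disk,
  against injectivity.\<close>

lemma univalent_boundary_limit_notin:
  fixes \<phi> :: "complex \<Rightarrow> complex"
  assumes cont: "continuous_on (ball 0 1) \<phi>" and inj: "inj_on \<phi> (ball 0 1)"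
    and lim: "((\<lambda>x::real. \<phi> (of_real x)) \<longlongrightarrow> L) (at_right (-1))"
  shows "L \<notin> \<phi> ` ball 0 1"
proof
  assume "L \<in> \<phi> ` ball 0 1"
  then obtain w where w: "norm w < 1" "L = \<phi> w" by auto
  \<comment> \<open>Any number strictly between \<open>norm w\<close> and \<open>1\<close> would
    do.\<close>
  define s where "s = (1 + norm w) / 2"
  have s: "norm w < s" "s < 1" "0 < s" using w norm_ge_zero[of w] by (auto simp: s_def simp del: norm_ge_zero)
  have "open (\<phi> ` ball 0 s)"
    using s by (intro invariance_of_domain continuous_on_subset[OF cont] inj_on_subset[OF inj]) auto
  moreover have "L \<in> \<phi> ` ball 0 s" using w s by auto
  ultimately have "\<forall>\<^sub>F x in at_right (-1::real). \<phi> (of_real x) \<in> \<phi> ` ball 0 s"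
    by (rule topological_tendstoD[OF lim])
  moreover have "\<forall>\<^sub>F x in at_right (-1::real). x \<in> {-1<..<-s}"
    using s by (intro eventually_at_right_real) auto
  ultimately have "\<forall>\<^sub>F x in at_right (-1::real). False"
  proof eventually_elim
    case (elim x)
    then obtain v where v: "norm v < s" "\<phi> (of_real x) = \<phi> v" by auto
    have "norm (complex_of_real x) < 1" using elim(2) s by simp
    then have "of_real x = v" using inj_onD[OF inj v(2)] v s by simp
    then show False using v(1) elim(2) s by auto
  qed
  then show False by simp
qed

lemma image_affine_unit_ball:
  fixes \<alpha> :: real
  assumes "\<alpha> > 0"
  shows "(\<lambda>z. 1 + of_real \<alpha> * z) ` ball 0 1 = ball (1 :: complex) \<alpha>"
proof (intro subset_antisym subsetI)
  fix w :: complex assume "w \<in> ball 1 \<alpha>"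
  then have "norm ((w - 1) / of_real \<alpha>) < 1" "w = 1 + of_real \<alpha> * ((w - 1) / of_real \<alpha>)"
    using assms by (simp_all add: dist_norm norm_divide norm_minus_commute)
  then show "w \<in> (\<lambda>z. 1 + of_real \<alpha> * z) ` ball 0 1" by (metis imageI mem_ball_0)
qed (use assms in \<open>auto simp: dist_norm norm_mult\<close>)

theorem theorem3p1:
  fixes n :: nat and \<phi> :: "complex \<Rightarrow> complex" and \<alpha> :: real
  assumes "n \<ge> 2"
    and "ma_minda \<phi>"
    and "largest_disk_radius 1 (\<phi> ` ball 0 1) \<alpha>"
    and "((\<lambda>x::real. \<phi> (of_real x)) \<longlongrightarrow> 1 - of_real \<alpha>) (at_right (-1))"
  shows "\<exists>r. is_C_radius \<phi> (poly (normalized_legendre (2 * n - 1))) r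
    \<and> is_C_radius (\<lambda>z. 1 + of_real \<alpha> * z) (poly (normalized_legendre (2 * n - 1))) r
    \<and> smallest_positive_root
        (\<lambda>x. of_real x * poly (pderiv (pderiv (normalized_legendre (2 * n - 1)))) (of_real x)
           + of_real \<alpha> * poly (pderiv (normalized_legendre (2 * n - 1))) (of_real x)) r"
proof -
  define f where "f = normalized_legendre (2 * n - 1)"
  have odd: "odd (2 * n - 1)" using \<open>n \<ge> 2\<close> by simp
  have cont: "continuous_on (ball 0 1) \<phi>" and inj: "inj_on \<phi> (ball 0 1)" and "\<phi> 0 = 1"
    using assms(2) by (auto simp: ma_minda_def holomorphic_on_imp_continuous_on)
  have sub: "ball 1 \<alpha> \<subseteq> \<phi> ` ball 0 1"
    and max: "\<And>\<beta>. ball 1 \<beta> \<subseteq> \<phi> ` ball 0 1 \<Longrightarrow> \<beta> \<le> \<alpha>"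
    using assms(3) by (auto simp: largest_disk_radius_def)
  \<comment> \<open>Positivity of \<open>\<alpha>\<close> is derived: the image is open and contains
    \<open>1\<close>, so some disk of positive radius fits inside.\<close>
  have "open (\<phi> ` ball 0 1)" by (intro invariance_of_domain cont inj) simp
  moreover have "1 \<in> \<phi> ` ball 0 1" using \<open>\<phi> 0 = 1\<close> by force
  ultimately obtain \<beta> where "\<beta> > 0" "ball 1 \<beta> \<subseteq> \<phi> ` ball 0 1"
    by (meson open_contains_ball)
  then have "\<alpha> > 0" using max by fastforce
  have f0: "poly f 0 = 0" "poly (pderiv f) 0 = 1"
    unfolding f_def by (rule normalized_legendre_0 [OF odd], rule pderiv_normalized_legendre_0 [OF odd])
  \<comment> \<open>The radius lemma is applied to the derivative of \<open>f\<close>, whose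
    logarithmic derivative times \<open>z\<close> is the quotient in the convexity
    condition.\<close>
  obtain r where r: "r > 0"
    "\<And>z. norm z < r \<Longrightarrow> poly (pderiv f) z \<noteq> 0 \<and>
      norm (z * poly (pderiv (pderiv f)) z / poly (pderiv f) z) < \<alpha>"
    "poly (pderiv f) (of_real r) \<noteq> 0"
    "of_real r * poly (pderiv (pderiv f)) (of_real r) / poly (pderiv f) (of_real r) = - of_real \<alpha>"
  proof (rule even_real_rooted_radius)
    show "poly (pderiv f) (- z) = poly (pderiv f) z" for z
      unfolding f_def by (rule pderiv_normalized_legendre_reflect [OF odd])
    show "real_rooted (pderiv f)"
      unfolding f_def by (rule real_rooted_pderiv_normalized_legendre [OF odd])
    \<comment> \<open>The degree is \<open>2 * n - 2\<close>, positive because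
      \<open>n \<ge> 2\<close>.\<close>
    show "degree (pderiv f) > 0"
      unfolding f_def degree_pderiv_normalized_legendre [OF odd] using \<open>n \<ge> 2\<close> by simp
    show "poly (pderiv f) 0 \<noteq> 0" using f0 by simp
  qed (use \<open>\<alpha> > 0\<close> in auto)
  have "is_C_radius \<phi> (poly f) r"
    by (rule is_C_radius_polyI [OF f0 r(1,2,4) sub
        univalent_boundary_limit_notin [OF cont inj assms(4)]])
  moreover have "is_C_radius (\<lambda>z. 1 + of_real \<alpha> * z) (poly f) r"
    \<comment> \<open>Here the image is exactly the open disk, and \<open>1 - \<alpha>\<close> lies
      on its bounding circle.\<close>
    using \<open>\<alpha> > 0\<close>
    by (intro is_C_radius_polyI [OF f0 r(1,2,4)]) (simp_all add: image_affine_unit_ball dist_norm)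
  moreover have "smallest_positive_root (\<lambda>x. of_real x * poly (pderiv (pderiv f)) (of_real x)
      + of_real \<alpha> * poly (pderiv f) (of_real x)) r"
    unfolding smallest_positive_root_def
  proof (intro conjI allI impI)
    show "of_real r * poly (pderiv (pderiv f)) (of_real r) + of_real \<alpha> * poly (pderiv f) (of_real r) = 0"
      using r(3,4) by (simp add: field_simps)
    fix s :: real
    assume s: "s > 0"
      "of_real s * poly (pderiv (pderiv f)) (of_real s) + of_real \<alpha> * poly (pderiv f) (of_real s) = 0"
    show "r \<le> s"
    proof (rule ccontr)
      assume "\<not> r \<le> s"
      then have *: "poly (pderiv f) (of_real s) \<noteq> 0"
        "norm (of_real s * poly (pderiv (pderiv f)) (of_real s) / poly (pderiv f) (of_real s)) < \<alpha>"
        using r(2)[of "of_real s"] s by auto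
      \<comment> \<open>A root below \<open>r\<close> would make the quotient have modulus exactly
        \<open>\<alpha>\<close>, while it is smaller inside the disk.\<close>
      have "of_real s * poly (pderiv (pderiv f)) (of_real s) / poly (pderiv f) (of_real s)
          = - of_real \<alpha>"
        using s *(1) by (simp add: field_simps eq_neg_iff_add_eq_0)
      then show False using *(2) \<open>\<alpha> > 0\<close> by simp
    qed
  qed (rule r(1))
  ultimately show ?thesis unfolding f_def by blast
qed

end
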